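(* Let $\mathcal{X}$ be a set, $n\ge 1$, and let $f:\mathcal{X}^n\to\mathbb{R}$ be sample-monotone. Let $t_1,t_2,\dots$ be any (data-independent) stream of potential outputs in $\mathbb{R}$, and let $\varepsilon_1,\varepsilon_2>0$. Consider the mechanism which, on input $\mathbf{x}\in\mathcal{X}^n$, runs $\texttt{AboveThreshold}$ on $\mathbf{x}$ with the query stream $q_i(\cdot)=\rho_f(\cdot\,;t_i)$, sensitivity parameter $\Delta=1$, threshold $T=0$ and noise parameters $\varepsilon_1,\varepsilon_2$, and, if $\texttt{AboveThreshold}$ outputs $\bot^{k-1}\top$, returns $t_k$. Then this mechanism is $(\varepsilon_1+2\varepsilon_2)$-differentially private, and it is $(\varepsilon_1+\varepsilon_2)$-differentially private if the query stream $\{\rho_f(\cdot\,;t_i)\}_i$ is monotonic.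
   Context: For $\mathbf{x},\mathbf{x}'\in\mathcal{X}^n$, $d_{\mathrm{ham}}(\mathbf{x},\mathbf{x}')=|\{i:\mathbf{x}_i\neq\mathbf{x}'_i\}|$; $\mathbf{x},\mathbf{x}'$ are neighboring if $d_{\mathrm{ham}}(\mathbf{x},\mathbf{x}')\le 1$. A randomized mechanism $M$ on $\mathcal{X}^n$ is $\varepsilon$-differentially private if for all neighboring $\mathbf{x},\mathbf{x}'$ and all measurable sets $S$ of outputs, $\Pr[M(\mathbf{x})\in S]\le e^{\varepsilon}\Pr[M(\mathbf{x}')\in S]$. Inverse sensitivity: $\mathrm{len}_f(\mathbf{x};t)=\inf\{d_{\mathrm{ham}}(\mathbf{x},\mathbf{x}') : \mathbf{x}'\in\mathcal{X}^n,\ f(\mathbf{x}')=t\}$ (with $\inf\emptyset=+\infty$). Reflective inverse sensitivity: $\rho_f(\mathbf{x};t)=\mathrm{sgn}(t-f(\mathbf{x}))\,(\mathrm{len}_f(\mathbf{x};t)-\tfrac12)$, where $\mathrm{sgn}(0)=0$ (so values $\pm\infty$ are possible). $f$ is sample-monotone if for every $\mathbf{x}\in\mathcal{X}^n$ and all $s,t\in\mathbb{R}$ with $f(\mathbf{x})\le s\le t$ or $t\le s\le f(\mathbf{x})$, we have $\mathrm{len}_f(\mathbf{x};s)\le \mathrm{len}_f(\mathbf{x};t)$. $\texttt{AboveThreshold}$ with input dataset $\mathbf{x}$, query stream $q_1,q_2,\dots$ (functions of the dataset), sensitivity $\Delta$, threshold $T$, parameters $\varepsilon_1,\varepsilon_2$: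 set $\hat T=T+Z$ with $Z$ drawn from the exponential distribution with scale $\Delta/\varepsilon_1$ (density $(\varepsilon_1/\Delta)e^{-z\varepsilon_1/\Delta}$ on $z\ge0$); then for $i=1,2,\dots$ draw independent $\nu_i$ exponential with scale $\Delta/\varepsilon_2$; if $q_i(\mathbf{x})+\nu_i\ge \hat T$ output $\top$ and halt, otherwise output $\bot$ and continue. A query stream $\{q_i\}$ is monotonic if for any neighboring $\mathbf{x},\mathbf{x}'$ either $q_i(\mathbf{x})\le q_i(\mathbf{x}')$ for all $i$ or $q_i(\mathbf{x})\ge q_i(\mathbf{x}')$ for all $i$. *)

theory Defs
  imports "HOL-Probability.Probability"
begin

definition datasets :: "nat \<Rightarrow> 'a set \<Rightarrow> (nat \<Rightarrow> 'a) set" where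
  "datasets n X = (\<Pi>\<^sub>E i\<in>{..<n}. X)"

definition hamming_dist :: "nat \<Rightarrow> (nat \<Rightarrow> 'a) \<Rightarrow> (nat \<Rightarrow> 'a) \<Rightarrow> nat" where
  "hamming_dist n x x' = card {i \<in> {..<n}. x i \<noteq> x' i}"

definition neighboring :: "nat \<Rightarrow> (nat \<Rightarrow> 'a) \<Rightarrow> (nat \<Rightarrow> 'a) \<Rightarrow> bool" where
  "neighboring n x x' \<longleftrightarrow> hamming_dist n x x' \<le> 1"

text \<open>A randomized mechanism with outputs in the measurable space \<open>N\<close> assigns to every dataset a
  probability measure on \<open>N\<close>, namely the law of its output.\<close>

definition differentially_private ::
    "nat \<Rightarrow> 'a set \<Rightarrow> 'b measure \<Rightarrow> real \<Rightarrow> ((nat \<Rightarrow> 'a) \<Rightarrow> 'b measure) \<Rightarrow> bool" where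
  "differentially_private n X N \<epsilon> M \<longleftrightarrow>
     (\<forall>x\<in>datasets n X. M x \<in> space (prob_algebra N)) \<and>
     (\<forall>x\<in>datasets n X. \<forall>x'\<in>datasets n X. neighboring n x x' \<longrightarrow>
        (\<forall>S\<in>sets N. measure (M x) S \<le> exp \<epsilon> * measure (M x') S))"

text \<open>The infimum is taken in \<^typ>\<open>ereal\<close>, where the infimum of the empty set is \<open>\<infinity>\<close>.\<close>

definition inverse_sensitivity ::
    "nat \<Rightarrow> 'a set \<Rightarrow> ((nat \<Rightarrow> 'a) \<Rightarrow> real) \<Rightarrow> (nat \<Rightarrow> 'a) \<Rightarrow> real \<Rightarrow> ereal" where
  "inverse_sensitivity n X f x t =
     (INF x'\<in>{x' \<in> datasets n X. f x' = t}. ereal (real (hamming_dist n x x')))"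

definition reflective_inverse_sensitivity ::
    "nat \<Rightarrow> 'a set \<Rightarrow> ((nat \<Rightarrow> 'a) \<Rightarrow> real) \<Rightarrow> (nat \<Rightarrow> 'a) \<Rightarrow> real \<Rightarrow> ereal" where
  "reflective_inverse_sensitivity n X f x t =
     ereal (sgn (t - f x)) * (inverse_sensitivity n X f x t - ereal (1/2))"

definition sample_monotone :: "nat \<Rightarrow> 'a set \<Rightarrow> ((nat \<Rightarrow> 'a) \<Rightarrow> real) \<Rightarrow> bool" where
  "sample_monotone n X f \<longleftrightarrow>
     (\<forall>x\<in>datasets n X. \<forall>s t. f x \<le> s \<and> s \<le> t \<or> t \<le> s \<and> s \<le> f x \<longrightarrow>
        inverse_sensitivity n X f x s \<le> inverse_sensitivity n X f x t)"

definition monotonic_stream :: "nat \<Rightarrow> 'a set \<Rightarrow> (nat \<Rightarrow> (nat \<Rightarrow> 'a) \<Rightarrow> ereal) \<Rightarrow> bool" where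
  "monotonic_stream n X q \<longleftrightarrow>
     (\<forall>x\<in>datasets n X. \<forall>x'\<in>datasets n X. neighboring n x x' \<longrightarrow>
        (\<forall>i. q i x \<le> q i x') \<or> (\<forall>i. q i x \<ge> q i x'))"

text \<open>The library's \<^const>\<open>exponential_density\<close> takes the rate, here the inverse of the scale \<open>b\<close>.\<close>

definition exponential_measure :: "real \<Rightarrow> real measure" where
  "exponential_measure b = density lborel (\<lambda>z. ennreal (exponential_density (1 / b) z))"

text \<open>Streams are indexed from 0. A run that answers \<open>\<bottom>\<close> exactly \<open>k\<close> times and then \<open>\<top>\<close> is
  encoded as \<open>Some k\<close>, and a run that answers \<open>\<bottom>\<close> forever as \<open>None\<close>.\<close>

definition above_threshold_run ::
    "(nat \<Rightarrow> 'd \<Rightarrow> ereal) \<Rightarrow> 'd \<Rightarrow> real \<Rightarrow> real \<Rightarrow> (nat \<Rightarrow> real) \<Rightarrow> nat option" where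
  "above_threshold_run q x T z \<nu> =
     (if \<exists>i. q i x + ereal (\<nu> i) \<ge> ereal (T + z)
      then Some (LEAST i. q i x + ereal (\<nu> i) \<ge> ereal (T + z))
      else None)"

text \<open>All the noise is drawn in advance; a run uses only the part of it up to its halting time.\<close>

definition above_threshold ::
    "(nat \<Rightarrow> 'd \<Rightarrow> ereal) \<Rightarrow> real \<Rightarrow> real \<Rightarrow> real \<Rightarrow> real \<Rightarrow> 'd \<Rightarrow> nat option measure" where
  "above_threshold q \<Delta> T \<epsilon>\<^sub>1 \<epsilon>\<^sub>2 x =
     distr (exponential_measure (\<Delta> / \<epsilon>\<^sub>1) \<Otimes>\<^sub>M (\<Pi>\<^sub>M i\<in>UNIV. exponential_measure (\<Delta> / \<epsilon>\<^sub>2)))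
       (count_space UNIV) (\<lambda>(z, \<nu>). above_threshold_run q x T z \<nu>)"

text \<open>The real line with one extra point \<open>None\<close>, the outcome of a run that never halts.\<close>

definition real_option_borel :: "real option measure" where
  "real_option_borel = sigma UNIV {S. Some -` S \<in> sets borel}"

definition inverse_sensitivity_mechanism ::
    "nat \<Rightarrow> 'a set \<Rightarrow> ((nat \<Rightarrow> 'a) \<Rightarrow> real) \<Rightarrow> (nat \<Rightarrow> real) \<Rightarrow> real \<Rightarrow> real \<Rightarrow> (nat \<Rightarrow> 'a)
      \<Rightarrow> real option measure" where
  "inverse_sensitivity_mechanism n X f t \<epsilon>\<^sub>1 \<epsilon>\<^sub>2 x =
     distr (above_threshold (\<lambda>i y. reflective_inverse_sensitivity n X f y (t i)) 1 0 \<epsilon>\<^sub>1 \<epsilon>\<^sub>2 x)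
       real_option_borel (map_option t)"

end

theory Submission
  imports Defs
begin

text \<open>Raising the threshold noise by \<open>s\<close> and the noise of the halting query by \<open>r\<close> turns every run
  on \<open>x\<close> that ends with outcome \<open>w\<close> into a run on \<open>x'\<close> with the same outcome, provided
  \<open>q x' \<le> q x + s \<le> q x' + r\<close>. Right shifts by \<open>s\<close> and \<open>r\<close> cost factors \<open>exp (\<epsilon>\<^sub>1 s)\<close> and \<open>exp (\<epsilon>\<^sub>2 r)\<close>
  for exponential noise. Sample-monotonicity makes the reflective inverse sensitivity
  1-Lipschitz between neighbours, so \<open>(s, r) = (1, 2)\<close> always works; for a monotonic stream
  \<open>(1, 1)\<close> works when the queries increase from \<open>x\<close> to \<open>x'\<close>, and \<open>(0, 1)\<close> when they decrease.\<close>

section \<open>Exponential noise under right shifts\<close>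

lemma prob_space_exponential_measure:
  assumes "b > 0"
  shows "prob_space (exponential_measure b)"
  unfolding exponential_measure_def using assms by (intro prob_space_exponential_density) simp

lemma sets_exponential_measure [measurable_cong, simp]: "sets (exponential_measure b) = sets borel"
  by (simp add: exponential_measure_def)

lemma space_exponential_measure [simp]: "space (exponential_measure b) = UNIV"
  by (simp add: exponential_measure_def)

text \<open>Substitution moves the shift from \<open>g\<close> to the density, and
  \<open>?d (z - s)\<close> equals \<open>exp (s / b) * ?d z\<close> for \<open>z \<ge> s\<close>
  and 0 for \<open>z < s\<close>. The sign of \<open>s\<close> matters: a left shift would put mass
  where \<open>?d\<close> vanishes, and no constant could bound it.\<close>

lemma nn_integral_exponential_measure_shift:
  assumes [measurable]: "g \<in> borel_measurable borel" and "b > 0" "s \<ge> 0"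
  shows "(\<integral>\<^sup>+z. g (z + s) \<partial>exponential_measure b)
           \<le> ennreal (exp (s / b)) * (\<integral>\<^sup>+z. g z \<partial>exponential_measure b)"
proof -
  let ?d = "exponential_density (1 / b)"
  have density_shift: "?d (z - s) \<le> exp (s / b) * ?d z" for z
    using assms by (auto simp: exponential_density_def exp_add[symmetric] diff_divide_distrib)
  have "(\<integral>\<^sup>+z. g (z + s) \<partial>exponential_measure b) = (\<integral>\<^sup>+z. ?d z * g (z + s) \<partial>lborel)"
    unfolding exponential_measure_def by (subst nn_integral_density) auto
  also have "\<dots> = (\<integral>\<^sup>+z. ?d (z - s) * g z \<partial>lborel)"
    by (subst nn_integral_real_affine[where c = 1 and t = s, of "\<lambda>z. ?d (z - s) * g z"])
      (auto simp: add.commute)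
  also have "\<dots> \<le> (\<integral>\<^sup>+z. ennreal (exp (s / b)) * (?d z * g z) \<partial>lborel)"
    using density_shift assms(2)
    by (intro nn_integral_mono)
      (auto simp: mult.assoc[symmetric] ennreal_mult[symmetric] exponential_density_nonneg
        intro!: mult_right_mono ennreal_leI)
  also have "\<dots> = ennreal (exp (s / b)) * (\<integral>\<^sup>+z. ?d z * g z \<partial>lborel)"
    by (rule nn_integral_cmult) auto
  also have "(\<integral>\<^sup>+z. ?d z * g z \<partial>lborel) = (\<integral>\<^sup>+z. g z \<partial>exponential_measure b)"
    unfolding exponential_measure_def by (subst nn_integral_density) auto
  finally show ?thesis .
qed

text \<open>The case of an indicator function, used for the noise of the halting query; the
  threshold noise needs the integral form.\<close>

lemma emeasure_exponential_measure_shift: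
  assumes [measurable]: "B \<in> sets borel" and "b > 0" "r \<ge> 0"
  shows "emeasure (exponential_measure b) {v. v + r \<in> B}
           \<le> ennreal (exp (r / b)) * emeasure (exponential_measure b) B"
proof -
  have "emeasure (exponential_measure b) {v. v + r \<in> B}
      = (\<integral>\<^sup>+v. indicator {v. v + r \<in> B} v \<partial>exponential_measure b)"
    by (rule nn_integral_indicator[symmetric]) measurable
  also have "\<dots> = (\<integral>\<^sup>+v. indicator B (v + r) \<partial>exponential_measure b)"
    by (simp add: indicator_def)
  also have "\<dots> \<le> ennreal (exp (r / b)) * (\<integral>\<^sup>+v. indicator B v \<partial>exponential_measure b)"
    by (rule nn_integral_exponential_measure_shift) (use assms in auto)
  finally show ?thesis by simp
qed

section \<open>The law of \<open>above_threshold\<close> on two datasets\<close>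

abbreviation noise_measure :: "real \<Rightarrow> (nat \<Rightarrow> real) measure" where
  "noise_measure b \<equiv> (\<Pi>\<^sub>M i\<in>UNIV. exponential_measure b)"

text \<open>Each single comparison is an event. Halting is then a countable union of events, and the
  halting time is the first of countably many events to occur.\<close>

lemma measurable_above_threshold_run [measurable]:
  "(\<lambda>(z, \<nu>). above_threshold_run q x T z \<nu>)
     \<in> measurable (exponential_measure a \<Otimes>\<^sub>M noise_measure b) (count_space UNIV)"
proof -
  let ?M = "exponential_measure a \<Otimes>\<^sub>M noise_measure b"
  have [measurable]: "(\<lambda>p. snd p i) \<in> borel_measurable ?M" for i :: nat
    using measurable_compose[OF measurable_snd measurable_component_singleton[of i UNIV]]
    by (simp cong: measurable_cong_sets)
  have [measurable]: "fst \<in> borel_measurable ?M"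
    using measurable_fst[of "exponential_measure a" "noise_measure b"]
    by (simp cong: measurable_cong_sets)
  let ?P = "\<lambda>i p. ereal (T + fst p) \<le> q i x + ereal (snd p i)"
  have P: "Measurable.pred ?M (?P i)" for i
    by measurable
  have "(\<lambda>p. if \<exists>i. ?P i p then Some (LEAST i. ?P i p) else None) \<in> measurable ?M (count_space UNIV)"
  proof (rule measurable_If)
    show "(\<lambda>p. Some (LEAST i. ?P i p)) \<in> measurable ?M (count_space UNIV)"
      by (rule measurable_compose[OF measurable_Least[OF P]]) simp
    show "{p \<in> space ?M. \<exists>i. ?P i p} \<in> sets ?M"
      using P unfolding pred_def by (intro sets.sets_Collect_countable_Ex)
  qed simp
  then show ?thesis
    by (simp add: above_threshold_run_def case_prod_beta)
qed

lemma above_threshold_run_eq_None_iff: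
  "above_threshold_run q x T z \<nu> = None \<longleftrightarrow> (\<forall>i. q i x + ereal (\<nu> i) < ereal (T + z))"
  by (auto simp: above_threshold_run_def not_le not_less)

lemma above_threshold_run_eq_Some_iff:
  "above_threshold_run q x T z \<nu> = Some k \<longleftrightarrow>
     (\<forall>i<k. q i x + ereal (\<nu> i) < ereal (T + z)) \<and> ereal (T + z) \<le> q k x + ereal (\<nu> k)"
  (is "_ \<longleftrightarrow> ?R")
proof
  assume "above_threshold_run q x T z \<nu> = Some k"
  then have ex: "\<exists>i. ereal (T + z) \<le> q i x + ereal (\<nu> i)"
    and k: "k = (LEAST i. ereal (T + z) \<le> q i x + ereal (\<nu> i))"
    by (auto simp: above_threshold_run_def split: if_splits)
  show ?R
    using LeastI_ex[OF ex] unfolding k by (auto simp: not_le dest: not_less_Least)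
next
  assume R: ?R
  then have "(LEAST i. ereal (T + z) \<le> q i x + ereal (\<nu> i)) = k"
    by (intro Least_equality) (auto simp: leD intro: leI)
  moreover have "\<exists>i. ereal (T + z) \<le> q i x + ereal (\<nu> i)"
    using R by blast
  ultimately show "above_threshold_run q x T z \<nu> = Some k"
    by (simp add: above_threshold_run_def)
qed

text \<open>With the threshold noise \<open>z\<close> fixed, the queries are answered independently.
  Once the threshold is raised by \<open>s\<close>, \<open>upper\<close> preserves every \<bottom>
  with unchanged noise, while \<open>lower\<close> preserves the final \<top> if that query's noise
  grows by \<open>r\<close>. So \<open>exp (r / b)\<close> is paid once, whatever the length of the
  run.\<close>

lemma above_threshold_run_shift:
  fixes q :: "nat \<Rightarrow> 'd \<Rightarrow> ereal"
  assumes "b > 0" "r \<ge> 0"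
    and upper: "\<And>i. q i x' \<le> q i x + ereal s"
    and lower: "\<And>i. q i x + ereal s \<le> q i x' + ereal r"
  shows "emeasure (noise_measure b) {\<nu>. above_threshold_run q x T z \<nu> = w}
      \<le> ennreal (exp (r / b)) *
        emeasure (noise_measure b) {\<nu>. above_threshold_run q x' T (z + s) \<nu> = w}"
proof -
  interpret E: prob_space "exponential_measure b"
    by (rule prob_space_exponential_measure) fact
  interpret product_prob_space "\<lambda>_. exponential_measure b" UNIV ..
  \<comment> \<open>Query values may be infinite, hence the case splits: \<open>upper\<close>
    carries \<open>-\<infinity>\<close> and \<open>lower\<close> carries \<open>\<infinity>\<close>
    from \<open>q i x\<close> over to \<open>q i x'\<close>.\<close>
  have below: "q i x' + ereal v < ereal (T + (z + s))" if "q i x + ereal v < ereal (T + z)" for i v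
    using that upper[of i] by (cases "q i x"; cases "q i x'") auto
  have above: "ereal (T + (z + s)) \<le> q i x' + ereal (v + r)"
    if "ereal (T + z) \<le> q i x + ereal v" for i v
    using that lower[of i] by (cases "q i x"; cases "q i x'") auto
  have one_le: "1 \<le> ennreal (exp (r / b))"
    using assms by (simp flip: ennreal_1)
  show ?thesis
  proof (cases w)
    \<comment> \<open>A run that never halts contains only \<bottom>, so the event for
      \<open>x\<close> lies inside the event for \<open>x'\<close> and the factor 1
      suffices.\<close>
    case None
    have "emeasure (noise_measure b) {\<nu>. above_threshold_run q x T z \<nu> = w}
        \<le> 1 * emeasure (noise_measure b) {\<nu>. above_threshold_run q x' T (z + s) \<nu> = w}"
      unfolding None above_threshold_run_eq_None_iff mult_1
    proof (rule emeasure_mono)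
      show "{\<nu>. \<forall>i. q i x + ereal (\<nu> i) < ereal (T + z)}
          \<subseteq> {\<nu>. \<forall>i. q i x' + ereal (\<nu> i) < ereal (T + (z + s))}"
        using below by auto
      have "{\<nu> \<in> space (noise_measure b). \<forall>i. \<nu> i \<in> {v. q i x' + ereal v < ereal (T + (z + s))}}
          \<in> sets (noise_measure b)"
        by (intro sets.sets_Collect_countable_All measurable_sets_Collect[OF
              measurable_component_singleton]) auto
      then show "{\<nu>. \<forall>i. q i x' + ereal (\<nu> i) < ereal (T + (z + s))} \<in> sets (noise_measure b)"
        by (simp add: space_PiM)
    qed
    also have "\<dots> \<le> ennreal (exp (r / b)) * \<dots>"
      unfolding mult_1 using mult_right_mono[OF one_le] by simp
    finally show ?thesis by simp
  next
    case (Some k)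
    \<comment> \<open>The outcome \<open>Some k\<close> restricts coordinates \<open>0..k\<close>
      separately, so its event is a box and its probability a product. \<open>A\<close> is only used
      for indices up to \<open>k\<close>, where the second branch means
      \<open>i = k\<close>.\<close>
    define A where "A y c i = (if i < k then {v. q i y + ereal v < ereal (T + c)}
      else {v. ereal (T + c) \<le> q i y + ereal v})" for y c i
    have A [measurable]: "A y c i \<in> sets borel" for y c i
      unfolding A_def by auto
    have run: "emeasure (noise_measure b) {\<nu>. above_threshold_run q y T c \<nu> = w}
        = (\<Prod>i<k. emeasure (exponential_measure b) (A y c i))
          * emeasure (exponential_measure b) (A y c k)" for y c
    proof -
      have "{\<nu>. above_threshold_run q y T c \<nu> = w}
          = {\<nu> \<in> space (noise_measure b). \<forall>i\<in>{..k}. \<nu> i \<in> A y c i}"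
        unfolding Some above_threshold_run_eq_Some_iff A_def
        by (auto simp: space_PiM le_less)
      also have "emeasure (noise_measure b) \<dots>
          = (\<Prod>i\<in>{..k}. emeasure (exponential_measure b) (A y c i))"
        by (rule emeasure_PiM_Collect) auto
      finally show ?thesis
        by (simp flip: lessThan_Suc_atMost)
    qed
    have "(\<Prod>i<k. emeasure (exponential_measure b) (A x z i))
        \<le> (\<Prod>i<k. emeasure (exponential_measure b) (A x' (z + s) i))"
      using below by (intro prod_mono_ennreal emeasure_mono) (auto simp: A_def)
    moreover have "emeasure (exponential_measure b) (A x z k)
        \<le> ennreal (exp (r / b)) * emeasure (exponential_measure b) (A x' (z + s) k)"
    proof -
      have "emeasure (exponential_measure b) (A x z k)
          \<le> emeasure (exponential_measure b) {v. v + r \<in> A x' (z + s) k}"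
      proof (rule emeasure_mono)
        show "A x z k \<subseteq> {v. v + r \<in> A x' (z + s) k}"
          using above by (auto simp: A_def)
        show "{v. v + r \<in> A x' (z + s) k} \<in> sets (exponential_measure b)"
          by simp
      qed
      also have "\<dots> \<le> ennreal (exp (r / b)) * emeasure (exponential_measure b) (A x' (z + s) k)"
        by (rule emeasure_exponential_measure_shift) (use assms in auto)
      finally show ?thesis .
    qed
    ultimately show ?thesis
      unfolding run by (subst mult.left_commute) (rule mult_mono, auto)
  qed
qed

text \<open>By Fubini, the probability of an outcome is the integral over \<open>z\<close> of its
  probability given \<open>z\<close>. The comparison at fixed \<open>z\<close> costs the factor for
  \<open>r\<close> and leaves \<open>z + s\<close> on the side of \<open>x'\<close>; shifting the
  threshold noise back to \<open>z\<close> costs the factor for \<open>s\<close>.\<close>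

lemma emeasure_above_threshold_shift:
  fixes q :: "nat \<Rightarrow> 'd \<Rightarrow> ereal"
  assumes "\<Delta> > 0" "\<epsilon>\<^sub>1 > 0" "\<epsilon>\<^sub>2 > 0" "s \<ge> 0" "r \<ge> 0"
    and "\<And>i. q i x' \<le> q i x + ereal s"
    and "\<And>i. q i x + ereal s \<le> q i x' + ereal r"
  shows "emeasure (above_threshold q \<Delta> T \<epsilon>\<^sub>1 \<epsilon>\<^sub>2 x) S
      \<le> ennreal (exp (\<epsilon>\<^sub>1 * s / \<Delta> + \<epsilon>\<^sub>2 * r / \<Delta>)) * emeasure (above_threshold q \<Delta> T \<epsilon>\<^sub>1 \<epsilon>\<^sub>2 x') S"
proof -
  let ?E = "exponential_measure (\<Delta> / \<epsilon>\<^sub>1)" and ?N = "noise_measure (\<Delta> / \<epsilon>\<^sub>2)"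
  let ?C = "ennreal (exp (\<epsilon>\<^sub>1 * s / \<Delta> + \<epsilon>\<^sub>2 * r / \<Delta>))"
  let ?p = "\<lambda>y w z. emeasure ?N {\<nu>. above_threshold_run q y T z \<nu> = w}"
  interpret E: prob_space "exponential_measure (\<Delta> / \<epsilon>\<^sub>2)"
    by (rule prob_space_exponential_measure) (use assms in simp)
  interpret N: product_prob_space "\<lambda>_. exponential_measure (\<Delta> / \<epsilon>\<^sub>2)" UNIV ..
  have pre [measurable]: "{(z, \<nu>). above_threshold_run q y T z \<nu> = w} \<in> sets (?E \<Otimes>\<^sub>M ?N)" for y w
  proof -
    have "(\<lambda>(z, \<nu>). above_threshold_run q y T z \<nu>) -` {w} \<inter> space (?E \<Otimes>\<^sub>M ?N) \<in> sets (?E \<Otimes>\<^sub>M ?N)"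
      by (rule measurable_sets[OF measurable_above_threshold_run]) simp
    also have "(\<lambda>(z, \<nu>). above_threshold_run q y T z \<nu>) -` {w} \<inter> space (?E \<Otimes>\<^sub>M ?N)
        = {(z, \<nu>). above_threshold_run q y T z \<nu> = w}"
      by (auto simp: space_pair_measure space_PiM)
    finally show ?thesis .
  qed
  have singleton: "emeasure (above_threshold q \<Delta> T \<epsilon>\<^sub>1 \<epsilon>\<^sub>2 y) {w} = (\<integral>\<^sup>+z. ?p y w z \<partial>?E)" for y w
  proof -
    have "emeasure (above_threshold q \<Delta> T \<epsilon>\<^sub>1 \<epsilon>\<^sub>2 y) {w}
        = emeasure (?E \<Otimes>\<^sub>M ?N) {(z, \<nu>). above_threshold_run q y T z \<nu> = w}"
      unfolding above_threshold_def
      by (subst emeasure_distr) (auto simp: space_pair_measure space_PiM intro!: arg_cong2[where f = emeasure])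
    also have "\<dots> = (\<integral>\<^sup>+z. ?p y w z \<partial>?E)"
      by (subst N.emeasure_pair_measure_alt[OF pre]) (simp add: vimage_def)
    finally show ?thesis .
  qed
  have p_measurable: "?p y w \<in> borel_measurable borel" for y w
    using N.measurable_emeasure_Pair[OF pre[of y w]]
    by (simp add: vimage_def cong: measurable_cong_sets)
  have point: "emeasure (above_threshold q \<Delta> T \<epsilon>\<^sub>1 \<epsilon>\<^sub>2 x) {w}
      \<le> ?C * emeasure (above_threshold q \<Delta> T \<epsilon>\<^sub>1 \<epsilon>\<^sub>2 x') {w}" for w
  proof -
    have meas: "(\<lambda>z. ?p x' w (z + s)) \<in> borel_measurable ?E"
      using measurable_compose[OF _ p_measurable, of "\<lambda>z. z + s" borel x' w]
      by (simp cong: measurable_cong_sets)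
    have "(\<integral>\<^sup>+z. ?p x w z \<partial>?E)
        \<le> (\<integral>\<^sup>+z. ennreal (exp (r / (\<Delta> / \<epsilon>\<^sub>2))) * ?p x' w (z + s) \<partial>?E)"
      by (intro nn_integral_mono above_threshold_run_shift) (use assms in auto)
    also have "\<dots> = ennreal (exp (r / (\<Delta> / \<epsilon>\<^sub>2))) * (\<integral>\<^sup>+z. ?p x' w (z + s) \<partial>?E)"
      by (rule nn_integral_cmult[OF meas])
    also have "\<dots> \<le> ennreal (exp (r / (\<Delta> / \<epsilon>\<^sub>2)))
        * (ennreal (exp (s / (\<Delta> / \<epsilon>\<^sub>1))) * (\<integral>\<^sup>+z. ?p x' w z \<partial>?E))"
      by (intro mult_left_mono nn_integral_exponential_measure_shift[OF p_measurable])
        (use assms in auto)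
    also have "\<dots> = ?C * (\<integral>\<^sup>+z. ?p x' w z \<partial>?E)"
      by (simp add: mult.assoc[symmetric] ennreal_mult[symmetric] exp_add[symmetric] ac_simps)
    finally show ?thesis
      unfolding singleton .
  qed
  \<comment> \<open>There are countably many outcomes, so the bound on singletons sums to a bound on
    every \<open>S\<close>.\<close>
  have sum: "emeasure (above_threshold q \<Delta> T \<epsilon>\<^sub>1 \<epsilon>\<^sub>2 y) S
      = (\<integral>\<^sup>+w. emeasure (above_threshold q \<Delta> T \<epsilon>\<^sub>1 \<epsilon>\<^sub>2 y) {w} \<partial>count_space S)" for y
    by (rule emeasure_countable_singleton) (auto simp: above_threshold_def)
  show ?thesis
    unfolding sum[of x] sum[of x'] using point
    by (subst nn_integral_cmult[symmetric]) (auto intro!: nn_integral_mono)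
qed

lemma prob_space_above_threshold:
  assumes "\<Delta> > 0" "\<epsilon>\<^sub>1 > 0" "\<epsilon>\<^sub>2 > 0"
  shows "prob_space (above_threshold q \<Delta> T \<epsilon>\<^sub>1 \<epsilon>\<^sub>2 x)"
proof -
  interpret E: prob_space "exponential_measure (\<Delta> / \<epsilon>\<^sub>1)"
    by (rule prob_space_exponential_measure) (use assms in simp)
  interpret E': prob_space "exponential_measure (\<Delta> / \<epsilon>\<^sub>2)"
    by (rule prob_space_exponential_measure) (use assms in simp)
  interpret N: product_prob_space "\<lambda>_. exponential_measure (\<Delta> / \<epsilon>\<^sub>2)" UNIV ..
  interpret pair_prob_space "exponential_measure (\<Delta> / \<epsilon>\<^sub>1)" "noise_measure (\<Delta> / \<epsilon>\<^sub>2)" ..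
  show ?thesis
    unfolding above_threshold_def by (rule prob_space_distr) measurable
qed

section \<open>Hamming distance and inverse sensitivity\<close>

lemma hamming_dist_commute: "hamming_dist n x y = hamming_dist n y x"
  unfolding hamming_dist_def by (simp add: eq_commute)

lemma hamming_dist_triangle: "hamming_dist n x z \<le> hamming_dist n x y + hamming_dist n y z"
proof -
  have "hamming_dist n x z \<le> card ({i \<in> {..<n}. x i \<noteq> y i} \<union> {i \<in> {..<n}. y i \<noteq> z i})"
    unfolding hamming_dist_def by (rule card_mono) auto
  also have "\<dots> \<le> hamming_dist n x y + hamming_dist n y z"
    unfolding hamming_dist_def by (rule card_Un_le)
  finally show ?thesis .
qed

text \<open>Members of \<open>datasets n X\<close> are \<open>undefined\<close> outside
  \<open>{..<n}\<close>, so agreement below \<open>n\<close> is already equality.\<close>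

lemma hamming_dist_eq_0:
  assumes "x \<in> datasets n X" "y \<in> datasets n X" "hamming_dist n x y = 0"
  shows "x = y"
proof (rule PiE_ext)
  show "x i = y i" if "i \<in> {..<n}" for i
    using assms(3) that by (auto simp: hamming_dist_def)
qed (use assms in \<open>auto simp: datasets_def\<close>)

lemma inverse_sensitivity_le:
  assumes "y \<in> datasets n X"
  shows "inverse_sensitivity n X f x (f y) \<le> ereal (real (hamming_dist n x y))"
  unfolding inverse_sensitivity_def by (rule INF_lower) (use assms in auto)

text \<open>A dataset on which \<open>f\<close> takes another value than \<open>f x\<close> differs
  from \<open>x\<close>, and distinct datasets have a positive integer distance.\<close>

lemma inverse_sensitivity_ge_1:
  assumes "x \<in> datasets n X" "f x \<noteq> t"
  shows "1 \<le> inverse_sensitivity n X f x t"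
  unfolding inverse_sensitivity_def
proof (rule INF_greatest)
  fix y assume "y \<in> {x' \<in> datasets n X. f x' = t}"
  then have "hamming_dist n x y \<noteq> 0"
    using hamming_dist_eq_0[of x n X y] assms by auto
  then show "1 \<le> ereal (real (hamming_dist n x y))"
    by simp
qed

text \<open>Distances are natural numbers, so the infimum is a minimum unless no dataset has the
  value \<open>t\<close>.\<close>

lemma inverse_sensitivity_attained:
  obtains "inverse_sensitivity n X f x t = \<infinity>"
  | y where "y \<in> datasets n X" "f y = t"
      "inverse_sensitivity n X f x t = ereal (real (hamming_dist n x y))"
proof (cases "\<exists>y. y \<in> datasets n X \<and> f y = t")
  case False
  then have "{x' \<in> datasets n X. f x' = t} = {}" by auto
  then have "inverse_sensitivity n X f x t = \<infinity>"
    unfolding inverse_sensitivity_def by (simp only: image_empty Inf_empty top_ereal_def)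
  then show ?thesis by (rule that(1))
next
  case True
  then obtain y where y: "y \<in> datasets n X" "f y = t"
    "\<And>y'. y' \<in> datasets n X \<and> f y' = t \<Longrightarrow> hamming_dist n x y \<le> hamming_dist n x y'"
    using ex_has_least_nat[of "\<lambda>y. y \<in> datasets n X \<and> f y = t" _ "hamming_dist n x"] by blast
  have "inverse_sensitivity n X f x t = ereal (real (hamming_dist n x y))"
    unfolding inverse_sensitivity_def
    by (intro antisym INF_lower INF_greatest) (use y in auto)
  with y show ?thesis by (intro that(2))
qed

text \<open>A dataset \<open>y\<close> closest to \<open>x'\<close> with \<open>f y = t\<close> is
  also a candidate for \<open>x\<close>, reached by way of \<open>x'\<close>. Without such a
  \<open>y\<close> the right side is \<infinity>.\<close>

lemma inverse_sensitivity_triangle: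
  "inverse_sensitivity n X f x t
     \<le> inverse_sensitivity n X f x' t + ereal (real (hamming_dist n x x'))"
proof (cases rule: inverse_sensitivity_attained[of n X f x' t])
  case (2 y)
  have "inverse_sensitivity n X f x t \<le> ereal (real (hamming_dist n x y))"
    using inverse_sensitivity_le[of y n X f x] 2 by simp
  also have "\<dots> \<le> ereal (real (hamming_dist n x' y + hamming_dist n x x'))"
    using hamming_dist_triangle[of n x y x'] by simp
  finally show ?thesis using 2 by simp
qed simp

text \<open>Sample-monotonicity enters only when \<open>t\<close> lies strictly between \<open>f x\<close> and \<open>f x'\<close>: it then
  forces both inverse sensitivities to be 1.\<close>

lemma reflective_inverse_sensitivity_neighboring:
  assumes mono: "sample_monotone n X f"
    and x: "x \<in> datasets n X" and x': "x' \<in> datasets n X" and nb: "neighboring n x x'"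
  shows "reflective_inverse_sensitivity n X f x t
      \<le> reflective_inverse_sensitivity n X f x' t + 1"
proof -
  let ?l = "inverse_sensitivity n X f x t" and ?l' = "inverse_sensitivity n X f x' t"
  have h: "hamming_dist n x x' \<le> 1" "hamming_dist n x' x \<le> 1"
    using nb by (simp_all add: neighboring_def hamming_dist_commute)
  have h1: "ereal (real (hamming_dist n x x')) \<le> 1" "ereal (real (hamming_dist n x' x)) \<le> 1"
    using h by simp_all
  have tri: "?l \<le> ?l' + 1" "?l' \<le> ?l + 1"
    using inverse_sensitivity_triangle[of n X f x t x'] inverse_sensitivity_triangle[of n X f x' t x]
      h1 by (meson add_left_mono order_trans)+
  have ge: "f x \<noteq> t \<Longrightarrow> 1 \<le> ?l" "f x' \<noteq> t \<Longrightarrow> 1 \<le> ?l'"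
    using inverse_sensitivity_ge_1 x x' by blast+
  have cross: "?l \<le> 1" if "f x \<le> t \<and> t \<le> f x' \<or> f x' \<le> t \<and> t \<le> f x"
  proof -
    have "?l \<le> inverse_sensitivity n X f x (f x')"
      using mono x that unfolding sample_monotone_def by blast
    also have "\<dots> \<le> 1"
      using inverse_sensitivity_le[OF x', of f x] h1 by (meson order_trans)
    finally show ?thesis .
  qed
  have cross': "?l' \<le> 1" if "f x \<le> t \<and> t \<le> f x' \<or> f x' \<le> t \<and> t \<le> f x"
  proof -
    have "?l' \<le> inverse_sensitivity n X f x' (f x)"
      using mono x' that unfolding sample_monotone_def by blast
    also have "\<dots> \<le> 1"
      using inverse_sensitivity_le[OF x, of f x'] h1 by (meson order_trans)
    finally show ?thesis .
  qed
  \<comment> \<open>If \<open>t\<close> is on the same side of both values, the two reflective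
    sensitivities differ by \<open>?l - ?l'\<close> up to sign, and \<open>tri\<close> applies. If
    \<open>f x < t < f x'\<close>, they are 1/2 and -1/2: the offset 1/2 makes this crossing cost
    exactly 1. If \<open>t\<close> equals one of two distinct values, the step is from 0 to 1/2 or
    -1/2. When \<open>f x' < t < f x\<close>, signs and \<open>ge\<close> suffice.\<close>
  show ?thesis
    unfolding reflective_inverse_sensitivity_def
    using tri ge cross cross'
    by (cases "f x" t rule: linorder_cases; cases "f x'" t rule: linorder_cases;
        cases ?l; cases ?l') (auto simp: one_ereal_def)
qed

section \<open>From the halting index to the mechanism\<close>

lemma space_real_option_borel [simp]: "space real_option_borel = UNIV"
  unfolding real_option_borel_def by (simp add: space_measure_of_conv)

text \<open>Privacy reduces to choosing shifts for each ordered pair of neighbours; they may depend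
  on the pair as long as their cost stays below \<open>\<epsilon>\<close>. Returning
  \<open>t k\<close> in place of \<open>k\<close> is post-processing: an event \<open>S\<close>
  about the output is the event \<open>map_option t -\<close> followed by \<open>S\<close> about the
  index.\<close>

lemma differentially_private_inverse_sensitivity_mechanism:
  assumes "\<epsilon>\<^sub>1 > 0" "\<epsilon>\<^sub>2 > 0"
    and shift: "\<And>x x'. x \<in> datasets n X \<Longrightarrow> x' \<in> datasets n X \<Longrightarrow> neighboring n x x' \<Longrightarrow>
      \<exists>s\<ge>0. \<exists>r\<ge>0. \<epsilon>\<^sub>1 * s + \<epsilon>\<^sub>2 * r \<le> \<epsilon> \<and>
        (\<forall>i. reflective_inverse_sensitivity n X f x' (t i)
              \<le> reflective_inverse_sensitivity n X f x (t i) + ereal s) \<and>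
        (\<forall>i. reflective_inverse_sensitivity n X f x (t i) + ereal s
              \<le> reflective_inverse_sensitivity n X f x' (t i) + ereal r)"
  shows "differentially_private n X real_option_borel \<epsilon>
    (inverse_sensitivity_mechanism n X f t \<epsilon>\<^sub>1 \<epsilon>\<^sub>2)"
proof -
  let ?q = "\<lambda>i y. reflective_inverse_sensitivity n X f y (t i)"
  let ?AT = "above_threshold ?q 1 0 \<epsilon>\<^sub>1 \<epsilon>\<^sub>2" and ?M = "inverse_sensitivity_mechanism n X f t \<epsilon>\<^sub>1 \<epsilon>\<^sub>2"
  have AT: "prob_space (?AT x)" for x
    using assms by (intro prob_space_above_threshold) auto
  \<comment> \<open>The halting index lives in a discrete space, so any stream \<open>t\<close>
    gives a measurable map.\<close>
  have meas: "map_option t \<in> measurable (?AT x) real_option_borel" for x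
    by (simp add: above_threshold_def)
  have M: "prob_space (?M x)" for x
    unfolding inverse_sensitivity_mechanism_def by (rule prob_space.prob_space_distr[OF AT meas])
  have emeasure_M: "emeasure (?M x) S = emeasure (?AT x) (map_option t -` S)"
    if "S \<in> sets real_option_borel" for x S
    unfolding inverse_sensitivity_mechanism_def
    by (subst emeasure_distr[OF meas that]) (simp add: above_threshold_def)
  show ?thesis
    unfolding differentially_private_def
  proof (intro conjI ballI impI)
    fix x show "?M x \<in> space (prob_algebra real_option_borel)"
      using M[of x] by (simp add: space_prob_algebra inverse_sensitivity_mechanism_def)
  next
    fix x x' S
    assume x: "x \<in> datasets n X" "x' \<in> datasets n X" "neighboring n x x'"
      and S: "S \<in> sets real_option_borel"
    interpret Mx: prob_space "?M x" by (rule M)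
    interpret Mx': prob_space "?M x'" by (rule M)
    obtain s r where sr: "s \<ge> 0" "r \<ge> 0" "\<epsilon>\<^sub>1 * s + \<epsilon>\<^sub>2 * r \<le> \<epsilon>"
      "\<And>i. ?q i x' \<le> ?q i x + ereal s" "\<And>i. ?q i x + ereal s \<le> ?q i x' + ereal r"
      using shift[OF x] by blast
    have "emeasure (?M x) S \<le> ennreal (exp (\<epsilon>\<^sub>1 * s / 1 + \<epsilon>\<^sub>2 * r / 1)) * emeasure (?M x') S"
      unfolding emeasure_M[OF S]
      by (rule emeasure_above_threshold_shift) (use assms sr in auto)
    then have "measure (?M x) S \<le> exp (\<epsilon>\<^sub>1 * s + \<epsilon>\<^sub>2 * r) * measure (?M x') S"
      by (simp add: Mx.emeasure_eq_measure Mx'.emeasure_eq_measure ennreal_mult[symmetric])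
    also have "\<dots> \<le> exp \<epsilon> * measure (?M x') S"
      using sr by (intro mult_right_mono) auto
    finally show "measure (?M x) S \<le> exp \<epsilon> * measure (?M x') S" .
  qed
qed

section \<open>Choice of the shifts for general and for monotonic streams\<close>

theorem theorem3p3:
  fixes X :: "'a set" and n :: nat and f :: "(nat \<Rightarrow> 'a) \<Rightarrow> real"
    and t :: "nat \<Rightarrow> real" and \<epsilon>\<^sub>1 \<epsilon>\<^sub>2 :: real
  assumes "n \<ge> 1"
    and "sample_monotone n X f"
    and "\<epsilon>\<^sub>1 > 0" and "\<epsilon>\<^sub>2 > 0"
  shows "differentially_private n X real_option_borel (\<epsilon>\<^sub>1 + 2 * \<epsilon>\<^sub>2)
           (inverse_sensitivity_mechanism n X f t \<epsilon>\<^sub>1 \<epsilon>\<^sub>2) \<and>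
         (monotonic_stream n X (\<lambda>i x. reflective_inverse_sensitivity n X f x (t i)) \<longrightarrow>
          differentially_private n X real_option_borel (\<epsilon>\<^sub>1 + \<epsilon>\<^sub>2)
            (inverse_sensitivity_mechanism n X f t \<epsilon>\<^sub>1 \<epsilon>\<^sub>2))"
proof -
  let ?q = "\<lambda>i y. reflective_inverse_sensitivity n X f y (t i)"
  have sens: "?q i x \<le> ?q i x' + ereal 1" "?q i x' \<le> ?q i x + ereal 1"
    if "x \<in> datasets n X" "x' \<in> datasets n X" "neighboring n x x'" for x x' i
    using reflective_inverse_sensitivity_neighboring[OF assms(2)] that
    by (simp_all add: neighboring_def hamming_dist_commute one_ereal_def[symmetric])
  have "\<exists>s\<ge>0. \<exists>r\<ge>0. \<epsilon>\<^sub>1 * s + \<epsilon>\<^sub>2 * r \<le> \<epsilon>\<^sub>1 + 2 * \<epsilon>\<^sub>2 \<and>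
      (\<forall>i. ?q i x' \<le> ?q i x + ereal s) \<and> (\<forall>i. ?q i x + ereal s \<le> ?q i x' + ereal r)"
    if "x \<in> datasets n X" "x' \<in> datasets n X" "neighboring n x x'" for x x'
  proof (rule exI[of _ 1], intro conjI, simp, rule exI[of _ 2], intro conjI allI)
    fix i
    \<comment> \<open>Of the shift 2, one unit makes up for a query value that may be lower by 1 on
      \<open>x'\<close>, the other for the raised threshold.\<close>
    have "?q i x + ereal 1 \<le> (?q i x' + ereal 1) + ereal 1"
      using sens(1)[OF that] by (rule add_right_mono)
    then show "?q i x + ereal 1 \<le> ?q i x' + ereal 2"
      by (simp add: add.assoc)
  qed (use sens[OF that] in auto)
  moreover have "\<exists>s\<ge>0. \<exists>r\<ge>0. \<epsilon>\<^sub>1 * s + \<epsilon>\<^sub>2 * r \<le> \<epsilon>\<^sub>1 + \<epsilon>\<^sub>2 \<and>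
      (\<forall>i. ?q i x' \<le> ?q i x + ereal s) \<and> (\<forall>i. ?q i x + ereal s \<le> ?q i x' + ereal r)"
    if ms: "monotonic_stream n X ?q"
      and x: "x \<in> datasets n X" "x' \<in> datasets n X" "neighboring n x x'" for x x'
  proof -
    consider "\<forall>i. ?q i x \<le> ?q i x'" | "\<forall>i. ?q i x \<ge> ?q i x'"
      using ms x unfolding monotonic_stream_def by blast
    then show ?thesis
    proof cases
      \<comment> \<open>Here the halting query has not dropped on \<open>x'\<close>, so its noise
        only has to make up for the threshold, raised by 1 to preserve the \<bottom>
        answers.\<close>
      case 1
      then show ?thesis
        using sens[OF x] by (intro exI[of _ 1] conjI) (auto intro: add_right_mono)
    next
      \<comment> \<open>Values that only drop preserve \<bottom> by themselves, so the threshold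
        stays and the halting query makes up for a drop of at most 1. The cost
        \<open>\<epsilon>\<^sub>2\<close> is within the budget.\<close>
      case 2
      then show ?thesis
        using sens[OF x] assms by (intro exI[of _ 0] conjI exI[of _ 1]) (auto simp flip: zero_ereal_def)
    qed
  qed
  ultimately show ?thesis
    using assms by (intro conjI impI differentially_private_inverse_sensitivity_mechanism) auto
qed

end
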